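(* Let $A\in\mathbb{R}^{m\times d}$ with $m>d>2$ and let $x\sim\mathcal{N}(0,I_d)$ or $x\sim\operatorname{Unif}(\sqrt d\,\mathbb{S}^{d-1})$. Then it holds that the matrices $A^TA$ and $M=\mathbb{E}\left(\frac{xx^T}{\|Ax\|^2}\right)$ can be diagonalized simultaneously. More precisely, if $A^TA=U\operatorname{diag}(\lambda_i)U^T$ with orthonormal $U$ with columns $u_i$, $i=1,\dots,d$, then $M=U\operatorname{diag}(\mu_i)U^T$, and the eigenvalues $\mu_i$ of $M$ fulfill $$\frac{1}{2(\lambda_1+\cdots+\lambda_d)}\frac{\Gamma(\tfrac d2)}{\Gamma(\tfrac{d+1}{2})}\le\mu_i=\mathbb{E}\left(\frac{\langle u_i,x\rangle^2}{\sum_{j=1}^d\lambda_j\langle u_j,x\rangle^2}\right)\le\frac{1}{d(\lambda_1\cdots\lambda_d)^{1/d}}\,\frac{1}{\pi^{d/2}}\,\Gamma\left(\tfrac32-\tfrac1d\right)\Gamma\left(\tfrac12-\tfrac1d\right)^{d-1}.$$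
   Context: $\|\cdot\|$ is the Euclidean norm, $\Gamma$ the Gamma function, $\mathcal{N}(0,I_d)$ the standard normal distribution on $\mathbb{R}^d$, and $\operatorname{Unif}(\sqrt d\,\mathbb{S}^{d-1})$ the uniform distribution on the sphere of radius $\sqrt d$ centered at the origin in $\mathbb{R}^d$. It is assumed throughout that the expectation defining $M$ exists. *)

theory Defs
  imports "HOL-Probability.Probability"
begin

definition diag_matrix :: "real ^ 'n \<Rightarrow> real ^ 'n ^ 'n" where
  "diag_matrix v = (\<chi> i j. if i = j then v $ i else 0)"

definition outer :: "real ^ 'n \<Rightarrow> real ^ 'n ^ 'n" where
  "outer x = (\<chi> i j. x $ i * x $ j)"

text \<open>\<open>N(0, I\<^sub>d)\<close>: its Lebesgue density is the product of the one-dimensional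
  standard normal densities, i.e. \<open>(2 \<pi>) powr (- d / 2) * exp (- (norm x)\<^sup>2 / 2)\<close>.\<close>

definition std_normal_vec :: "(real ^ 'n) measure" where
  "std_normal_vec = density lborel (\<lambda>x. ennreal (\<Prod>i\<in>UNIV. std_normal_density (x $ i)))"

text \<open>The uniform distribution (normalised surface measure) on the sphere of radius
  \<open>r\<close> around the origin: a Borel set \<open>B\<close> of the sphere gets the proportion of the
  volume of the unit ball taken up by the cone \<open>{y. (r / norm y) *\<^sub>R y \<in> B}\<close> over
  \<open>B\<close>. The null set \<open>{0}\<close>, where the radial projection is not defined, is irrelevant.\<close>

definition unif_sphere :: "real \<Rightarrow> (real ^ 'n) measure" where
  "unif_sphere r =
     distr (uniform_measure lborel (ball 0 1)) borel (\<lambda>y. (r / norm y) *\<^sub>R y)"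

lemma prob_space_unif_sphere: "prob_space (unif_sphere r :: (real ^ 'n) measure)"
proof -
  have "Gamma (real CARD('n) / 2 + 1) \<noteq> 0"
    by (rule less_imp_neq[symmetric], rule Gamma_real_pos) (auto intro: add_nonneg_pos)
  then have "emeasure lborel (ball (0 :: real ^ 'n) 1) \<noteq> 0"
    by (simp add: emeasure_ball unit_ball_vol_def)
  moreover have "emeasure lborel (ball (0 :: real ^ 'n) 1) \<noteq> \<infinity>"
    using emeasure_lborel_ball_finite[of "0 :: real ^ 'n" 1] by auto
  ultimately have "prob_space (uniform_measure lborel (ball (0 :: real ^ 'n) 1))"
    by (rule prob_space_uniform_measure)
  then show ?thesis
    unfolding unif_sphere_def by (rule prob_space.prob_space_distr) measurable
qed

lemma AE_unif_sphere:
  assumes "r > 0"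
  shows "AE x in (unif_sphere r :: (real ^ 'n) measure). norm x = r"
proof -
  have "AE y in lborel. y \<noteq> (0 :: real ^ 'n)"
    by (rule AE_lborel_singleton)
  then have "AE y in uniform_measure lborel (ball (0 :: real ^ 'n) 1).
               norm ((r / norm y) *\<^sub>R y) = r"
    using assms by (intro AE_uniform_measureI) auto
  then show ?thesis
    unfolding unif_sphere_def by (subst AE_distr_iff) auto
qed

end

theory Submission
  imports Defs
begin

text \<open>
  The matrix-valued function \<open>x \<mapsto> outer x / (norm (A *v x))\<^sup>2\<close> is homogeneous of degree 0. Since the
  radial projection of a standard normal vector to a sphere is uniformly distributed
  (\<open>distr_std_normal_vec_normalise\<close>), its expectation is the same under both laws
  (\<open>homogeneous_integral_eq_gaussian\<close>), and one may assume that \<open>X\<close> is standard normal.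

  Let \<open>transpose A ** A = U ** diag_matrix lam ** transpose U\<close>. The coordinates \<open>y j = column j U \<bullet> X\<close>
  are again independent standard normal variables, because the Gaussian law is invariant under
  orthogonal maps, and the squared norm of \<open>A *v X\<close> is \<open>Q = (\<Sum>j. lam j * (y j)\<^sup>2)\<close>. The \<open>i, j\<close> entry of
  \<open>transpose U ** M ** U\<close> is the expectation of \<open>y i * y j / Q\<close>. For \<open>i \<noteq> j\<close> it vanishes, since the
  integrand is odd in \<open>y i\<close>. So \<open>U\<close> diagonalises \<open>M\<close> as well (\<open>second_moment_diagonalized\<close>), with
  eigenvalues \<open>mu i = E ((y i)\<^sup>2 / Q)\<close>. That some \<open>U\<close> exists is the spectral theorem for real
  symmetric matrices (\<open>symmetric_matrix_diagonalizable\<close>).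

  The lower bound is the Cauchy-Schwarz inequality \<open>(E \<bar>y i\<bar>)\<^sup>2 \<le> E ((y i)\<^sup>2 / Q) * E Q\<close>, which gives
  \<open>mu i \<ge> 2 / (pi * (\<Sum>j. lam j))\<close> (\<open>gaussian_quotient_lower_bound\<close>); the stated bound is weaker, because
  the ratio of Gamma values in it is at most \<open>4 / pi\<close> (\<open>Gamma_half_ratio_le\<close>). The upper bound is the inequality
  of arithmetic and geometric means in the denominator, followed by an exact evaluation: the
  expectation of a product of powers of independent normal variables is a product of absolute
  moments, each an explicit multiple of a value of the Gamma function (\<open>gaussian_quotient_upper_bound\<close>,
  \<open>nn_integral_gaussian_abs_moment\<close>).
\<close>

section \<open>Diagonalisation of real symmetric matrices\<close>

text \<open>
  The variational proof of the spectral theorem: the orthogonal complement \<open>W\<close> of a set of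
  eigenvectors is invariant under \<open>S\<close>, and a maximiser \<open>v\<close> of the quadratic form \<open>q\<close> on the unit
  sphere of \<open>W\<close> is an eigenvector, because the first variation of \<open>q\<close> at \<open>v\<close> in the direction of
  the residual \<open>w = S v - q(v) v\<close> is a multiple of the square of the norm of \<open>w\<close>.
\<close>

lemma symmetric_eigenvector_orthogonal_to:
  fixes S :: "real ^ 'n ^ 'n" and B :: "(real ^ 'n) set"
  assumes sym: "transpose S = S"
    and eig: "\<And>b. b \<in> B \<Longrightarrow> \<exists>c. S *v b = c *\<^sub>R b"
    and small: "dim B < CARD('n)"
  obtains v c where "norm v = 1" "S *v v = c *\<^sub>R v" "\<And>b. b \<in> B \<Longrightarrow> b \<bullet> v = 0"
proof -
  define q where "q x = x \<bullet> (S *v x)" for x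
  define W where "W = {x. \<forall>b\<in>B. b \<bullet> x = 0}"
  have sym': "x \<bullet> (S *v y) = (S *v x) \<bullet> y" for x y
    by (metis dot_lmul_matrix sym vector_transpose_matrix)
  have W_sub: "x + a *\<^sub>R y \<in> W" "a *\<^sub>R y \<in> W" if "x \<in> W" "y \<in> W" for x y a
    using that by (auto simp: W_def inner_simps)
  have W_inv: "S *v x \<in> W" if "x \<in> W" for x
    unfolding W_def
  proof (clarify)
    fix b assume "b \<in> B"
    then obtain c where "S *v b = c *\<^sub>R b" using eig by blast
    with that \<open>b \<in> B\<close> show "b \<bullet> (S *v x) = 0"
      by (simp add: sym' W_def)
  qed
  have "closed W"
    unfolding W_def Collect_ball_eq by (intro closed_INT ballI closed_Collect_eq continuous_intros)
  then have "compact (W \<inter> sphere 0 1)"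
    using compact_Int_closed[OF compact_sphere, of W 0 1] by (simp add: Int_commute)
  moreover have "W \<inter> sphere 0 1 \<noteq> {}"
  proof -
    obtain x where x: "x \<noteq> 0" "\<And>y. y \<in> span B \<Longrightarrow> orthogonal x y"
      using orthogonal_to_subspace_exists[of B] small by auto
    then have "x /\<^sub>R norm x \<in> W \<inter> sphere 0 1"
      by (auto simp: W_def orthogonal_def inner_commute span_base)
    then show ?thesis by blast
  qed
  moreover have "continuous_on (W \<inter> sphere 0 1) q"
    unfolding q_def by (intro continuous_intros)
  ultimately obtain v where "v \<in> W \<inter> sphere 0 1" "\<forall>x\<in>W \<inter> sphere 0 1. q x \<le> q v"
    using continuous_attains_sup by metis
  then have v: "v \<in> W" "norm v = 1"
    and max: "\<And>x. x \<in> W \<Longrightarrow> norm x = 1 \<Longrightarrow> q x \<le> q v"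
    by auto
  have vv: "v \<bullet> v = 1"
    using v by (simp add: dot_square_norm)
  have max': "q x \<le> q v * (x \<bullet> x)" if "x \<in> W" for x
  proof (cases "x = 0")
    case False
    have "q (x /\<^sub>R norm x) \<le> q v"
      using False that W_sub(2)[OF that that] by (intro max) auto
    moreover have "q (x /\<^sub>R norm x) = q x / (x \<bullet> x)"
      unfolding q_def by (simp add: matrix_vector_mult_scaleR dot_square_norm power2_eq_square divide_simps)
    ultimately show ?thesis
      using False by (simp add: divide_le_eq split: if_splits)
  qed (simp add: q_def)
  define w where "w = S *v v - q v *\<^sub>R v"
  have w: "w \<in> W"
    using W_sub(1)[OF W_inv[OF v(1)] v(1), of "- q v"] by (simp add: w_def)
  have wv: "w \<bullet> v = 0"
    by (simp add: w_def inner_simps vv q_def inner_commute)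
  have wSv: "w \<bullet> (S *v v) = w \<bullet> w"
    using wv by (simp add: w_def inner_simps)
  have quad: "2 * t * (w \<bullet> w) \<le> t\<^sup>2 * (q v * (w \<bullet> w) - q w)" for t
  proof -
    have "q (v + t *\<^sub>R w) = q v + 2 * t * (w \<bullet> w) + t\<^sup>2 * q w"
      unfolding q_def using wSv sym'[of v w]
      by (simp add: matrix_vector_right_distrib matrix_vector_mult_scaleR inner_simps
          inner_commute power2_eq_square algebra_simps)
    moreover have "(v + t *\<^sub>R w) \<bullet> (v + t *\<^sub>R w) = 1 + t\<^sup>2 * (w \<bullet> w)"
      using wv vv by (simp add: inner_simps inner_commute power2_eq_square algebra_simps)
    ultimately show ?thesis
      using max'[OF W_sub(1)[OF v(1) w, of t]] by (simp add: algebra_simps)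
  qed
  \<comment> \<open>The left side of \<open>quad\<close> is linear and the right side quadratic in \<open>t\<close>, so a small \<open>t > 0\<close> refutes \<open>w \<noteq> 0\<close>.\<close>
  have "w \<bullet> w \<le> 0"
  proof (rule ccontr)
    define K where "K = q v * (w \<bullet> w) - q w"
    assume "\<not> w \<bullet> w \<le> 0"
    then have pos: "w \<bullet> w > 0" by linarith
    define t where "t = (w \<bullet> w) / (\<bar>K\<bar> + 1)"
    have t: "t > 0" using pos by (simp add: t_def)
    have "2 * (w \<bullet> w) \<le> t * K"
      using quad[of t] t by (simp add: K_def power2_eq_square)
    also have "\<dots> \<le> t * (\<bar>K\<bar> + 1)"
      using t by (intro mult_left_mono) auto
    also have "\<dots> = w \<bullet> w"
      by (simp add: t_def)
    finally show False using pos by simp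
  qed
  then have "w = 0"
    by (meson inner_gt_zero_iff not_less)
  then have "S *v v = q v *\<^sub>R v"
    by (simp add: w_def)
  with v that show ?thesis
    by (auto simp: W_def)
qed

text \<open>
  An orthonormal set of eigenvectors with the largest possible number of elements is a basis:
  otherwise the previous lemma would enlarge it. Its elements are the columns of \<open>U\<close>.
\<close>

theorem symmetric_matrix_diagonalizable:
  fixes S :: "real ^ 'n ^ 'n"
  assumes sym: "transpose S = S"
  obtains U lam where "orthogonal_matrix U" "S = U ** diag_matrix lam ** transpose U"
proof -
  define ok where "ok B \<longleftrightarrow> pairwise orthogonal B \<and> (\<forall>b\<in>B. norm b = 1 \<and> (\<exists>c. S *v b = c *\<^sub>R b))"
    for B :: "(real ^ 'n) set"
  have indep: "independent B" if "ok B" for B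
    using that by (intro pairwise_orthogonal_independent) (auto simp: ok_def)
  have bound: "finite B \<and> card B \<le> CARD('n)" if "ok B" for B
    using independent_bound[OF indep[OF that]] by simp
  have "ok {}" by (simp add: ok_def)
  then obtain B where B: "ok B" and Bmax: "\<And>C. ok C \<Longrightarrow> card C \<le> card B"
    using ex_has_greatest_nat[of ok "{}" card "Suc CARD('n)"] bound by (metis less_Suc_eq_le)
  have "card B = CARD('n)"
  proof (rule ccontr)
    assume "card B \<noteq> CARD('n)"
    then have "dim B < CARD('n)"
      using bound[OF B] dim_eq_card_independent[OF indep[OF B]] by simp
    then obtain v c where v: "norm v = 1" "S *v v = c *\<^sub>R v" "\<And>b. b \<in> B \<Longrightarrow> b \<bullet> v = 0"
      using symmetric_eigenvector_orthogonal_to[OF sym, of B] B by (auto simp: ok_def)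
    have "v \<notin> B" using v by force
    moreover have "ok (insert v B)"
      using B v by (auto simp: ok_def pairwise_insert orthogonal_def inner_commute)
    ultimately show False
      using Bmax[of "insert v B"] bound[OF B] by simp
  qed
  then obtain h :: "'n \<Rightarrow> real ^ 'n" where h: "bij_betw h UNIV B"
    using bound[OF B] finite_same_card_bij[of "UNIV :: 'n set" B] by auto
  have "\<exists>c. S *v h i = c *\<^sub>R h i" for i
    using B h by (auto simp: ok_def bij_betw_def)
  then obtain l where l: "\<And>i. S *v h i = l i *\<^sub>R h i"
    by metis
  define U :: "real ^ 'n ^ 'n" where "U = (\<chi> i j. h j $ i)"
  define lam where "lam = vec_lambda l"
  have col: "column j U = h j" for j
    by (simp add: U_def column_def vec_eq_iff)
  have U: "orthogonal_matrix U"
    unfolding orthogonal_matrix_orthonormal_columns col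
    using B h by (fastforce simp: ok_def bij_betw_def pairwise_def inj_on_def)
  have "S ** U = U ** diag_matrix lam"
  proof (simp add: vec_eq_iff, intro allI)
    fix i j
    have "(S ** U) $ i $ j = (S *v h j) $ i"
      by (simp add: matrix_matrix_mult_def matrix_vector_mult_def U_def)
    also have "\<dots> = (U ** diag_matrix lam) $ i $ j"
      by (simp add: l matrix_matrix_mult_def U_def diag_matrix_def lam_def if_distrib cong: if_cong)
    finally show "(S ** U) $ i $ j = (U ** diag_matrix lam) $ i $ j" .
  qed
  then have "S = U ** diag_matrix lam ** transpose U"
    using U by (metis matrix_mul_assoc matrix_mul_rid orthogonal_matrix_def)
  with U that show ?thesis by blast
qed

section \<open>Lebesgue measure under orthogonal maps\<close>

lemma nn_integral_lborel_affine:
  fixes f :: "'a::euclidean_space \<Rightarrow> ennreal"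
  assumes [measurable]: "f \<in> borel_measurable borel" and c: "c \<noteq> 0"
  shows "(\<integral>\<^sup>+x. f x \<partial>lborel) = ennreal (\<bar>c\<bar> ^ DIM('a)) * (\<integral>\<^sup>+x. f (t + c *\<^sub>R x) \<partial>lborel)"
  by (subst lborel_affine[OF c, of t])
     (simp add: nn_integral_density nn_integral_distr nn_integral_cmult)

text \<open>
  Uniqueness of Haar measure in the form needed here. Let \<open>f\<close> be the indicator of the unit ball,
  which \<open>T\<close> leaves fixed. By Tonelli and the invariance of Lebesgue measure under translations and
  under point reflections, the product of the integrals of \<open>f\<close> and of \<open>g \<circ> T\<close> equals the product
  of the integrals of \<open>f\<close> and of \<open>g\<close>; the integral of \<open>f\<close> is positive and finite, so it cancels.
\<close>

lemma nn_integral_lborel_orthogonal: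
  fixes T :: "'a::euclidean_space \<Rightarrow> 'a" and g :: "'a \<Rightarrow> ennreal"
  assumes T: "orthogonal_transformation T" and g [measurable]: "g \<in> borel_measurable borel"
  shows "(\<integral>\<^sup>+x. g (T x) \<partial>lborel) = (\<integral>\<^sup>+x. g x \<partial>lborel)"
proof -
  define f :: "'a \<Rightarrow> ennreal" where "f = indicator (ball 0 1)"
  have "linear T"
    using T by (rule orthogonal_transformation_linear)
  moreover have "inj T"
    by (rule linear_injective_0[OF \<open>linear T\<close>, THEN iffD2])
       (metis T orthogonal_transformation_norm norm_eq_zero)
  ultimately obtain S where "linear S" and S: "\<And>x. T (S x) = x" "\<And>x. S (T x) = x"
    using linear_injective_isomorphism[of T] by auto
  note lin = \<open>linear T\<close> \<open>linear S\<close>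
  have [measurable]: "T \<in> borel_measurable borel" "S \<in> borel_measurable borel"
    by (intro borel_measurable_continuous_onI linear_continuous_on lin[unfolded linear_conv_bounded_linear])+
  have [measurable]: "f \<in> borel_measurable borel"
    unfolding f_def by (rule borel_measurable_indicator) simp
  have f_inv: "f (T x) = f x" for x
    by (simp add: f_def indicator_def orthogonal_transformation_norm[OF T])
  have shift: "(\<integral>\<^sup>+x. h (t + x) \<partial>lborel) = (\<integral>\<^sup>+x. h x \<partial>lborel)"
    if [measurable]: "h \<in> borel_measurable borel" for h :: "'a \<Rightarrow> ennreal" and t
    using nn_integral_lborel_affine[of h 1 t] by simp
  have reflect: "(\<integral>\<^sup>+x. h (t - x) \<partial>lborel) = (\<integral>\<^sup>+x. h x \<partial>lborel)"
    if [measurable]: "h \<in> borel_measurable borel" for h :: "'a \<Rightarrow> ennreal" and t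
    using nn_integral_lborel_affine[of h "-1" t] by simp
  have "(\<integral>\<^sup>+x. f x \<partial>lborel) * (\<integral>\<^sup>+y. g (T y) \<partial>lborel)
      = (\<integral>\<^sup>+x. f x * (\<integral>\<^sup>+y. g (T y) \<partial>lborel) \<partial>lborel)"
    by (simp add: nn_integral_multc)
  \<comment> \<open>Translating \<open>y\<close> by \<open>S x\<close> turns \<open>T y\<close> into \<open>x + T y\<close>.\<close>
  also have "\<dots> = (\<integral>\<^sup>+x. f x * (\<integral>\<^sup>+y. g (x + T y) \<partial>lborel) \<partial>lborel)"
  proof (rule nn_integral_cong)
    fix x
    have "(\<integral>\<^sup>+y. g (T (S x + y)) \<partial>lborel) = (\<integral>\<^sup>+y. g (T y) \<partial>lborel)"
      by (rule shift) measurable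
    then show "f x * (\<integral>\<^sup>+y. g (T y) \<partial>lborel) = f x * (\<integral>\<^sup>+y. g (x + T y) \<partial>lborel)"
      using S by (simp add: linear_add[OF lin(1)])
  qed
  also have "\<dots> = (\<integral>\<^sup>+x. (\<integral>\<^sup>+y. f x * g (x + T y) \<partial>lborel) \<partial>lborel)"
    by (simp add: nn_integral_cmult)
  also have "\<dots> = (\<integral>\<^sup>+y. (\<integral>\<^sup>+x. f x * g (x + T y) \<partial>lborel) \<partial>lborel)"
    by (rule lborel_pair.Fubini') measurable
  also have "\<dots> = (\<integral>\<^sup>+y. (\<integral>\<^sup>+x. f (x - T y) * g x \<partial>lborel) \<partial>lborel)"
  proof (rule nn_integral_cong)
    fix y
    show "(\<integral>\<^sup>+x. f x * g (x + T y) \<partial>lborel) = (\<integral>\<^sup>+x. f (x - T y) * g x \<partial>lborel)"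
      using shift[of "\<lambda>x. f x * g (x + T y)" "- T y"] by (simp add: algebra_simps)
  qed
  also have "\<dots> = (\<integral>\<^sup>+x. (\<integral>\<^sup>+y. f (x - T y) * g x \<partial>lborel) \<partial>lborel)"
    by (rule lborel_pair.Fubini') measurable
  \<comment> \<open>Here \<open>f \<circ> T = f\<close> removes \<open>T\<close> from the inner integral.\<close>
  also have "\<dots> = (\<integral>\<^sup>+x. (\<integral>\<^sup>+y. f (S x - y) \<partial>lborel) * g x \<partial>lborel)"
  proof (rule nn_integral_cong)
    fix x
    have "f (x - T y) = f (S x - y)" for y
      using f_inv[of "S x - y"] S by (simp add: linear_diff[OF lin(1)])
    then show "(\<integral>\<^sup>+y. f (x - T y) * g x \<partial>lborel) = (\<integral>\<^sup>+y. f (S x - y) \<partial>lborel) * g x"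
      by (simp add: nn_integral_multc)
  qed
  also have "\<dots> = (\<integral>\<^sup>+x. f x \<partial>lborel) * (\<integral>\<^sup>+x. g x \<partial>lborel)"
    by (simp add: reflect nn_integral_cmult)
  finally have eq: "(\<integral>\<^sup>+x. f x \<partial>lborel) * (\<integral>\<^sup>+y. g (T y) \<partial>lborel)
      = (\<integral>\<^sup>+x. f x \<partial>lborel) * (\<integral>\<^sup>+x. g x \<partial>lborel)" .
  have "(\<integral>\<^sup>+x. f x \<partial>lborel) = emeasure lborel (ball (0::'a) 1)"
    unfolding f_def by simp
  moreover have "emeasure lborel (ball (0::'a) 1) \<noteq> 0"
    by (simp add: emeasure_ball unit_ball_vol_def Gamma_real_pos less_imp_neq[symmetric])
  moreover have "emeasure lborel (ball (0::'a) 1) \<noteq> top"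
    using emeasure_lborel_ball_finite[of "0::'a" 1] by auto
  ultimately show ?thesis
    using eq by (simp add: ennreal_mult_cancel_left)
qed

section \<open>The standard normal distribution\<close>

lemma prod_std_normal_density:
  "(\<Prod>i\<in>UNIV. std_normal_density (x $ i))
     = (1 / sqrt (2 * pi)) ^ CARD('n) * exp (- (norm x)\<^sup>2 / 2)" for x :: "real ^ 'n"
proof -
  have "(norm x)\<^sup>2 = (\<Sum>i\<in>UNIV. (x $ i)\<^sup>2)"
    unfolding norm_vec_def L2_set_def by (simp add: sum_nonneg)
  then show ?thesis
    unfolding std_normal_density_def prod.distrib
    by (simp add: exp_sum[symmetric] sum_negf sum_divide_distrib)
qed

lemma std_normal_vec_eq:
  "(std_normal_vec :: (real ^ 'n) measure)
     = density lborel (\<lambda>x. ennreal ((1 / sqrt (2 * pi)) ^ CARD('n) * exp (- (norm x)\<^sup>2 / 2)))"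
  unfolding std_normal_vec_def prod_std_normal_density ..

lemma sets_std_normal_vec [simp, measurable_cong]: "sets std_normal_vec = sets borel"
  by (simp add: std_normal_vec_def)

lemma space_std_normal_vec [simp]: "space std_normal_vec = UNIV"
  by (simp add: std_normal_vec_def)

text \<open>
  The density and Lebesgue measure are both products over the coordinates; this is the independence
  of the coordinates.
\<close>

lemma nn_integral_std_normal_vec_prod:
  fixes f :: "'n::finite \<Rightarrow> real \<Rightarrow> ennreal"
  assumes [measurable]: "\<And>i. f i \<in> borel_measurable borel"
  shows "(\<integral>\<^sup>+x. (\<Prod>i\<in>UNIV. f i (x $ i)) \<partial>std_normal_vec)
       = (\<Prod>i\<in>UNIV. \<integral>\<^sup>+t. f i t * ennreal (std_normal_density t) \<partial>lborel)"
proof -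
  define ax where "ax = (\<lambda>i::'n. axis i (1::real))"
  have ax: "Basis = range ax" "inj ax"
    by (auto simp: Basis_vec_def ax_def inj_def axis_eq_axis)
  define g where "g b t = f (inv ax b) t * ennreal (std_normal_density t)" for b t
  have [measurable]: "g b \<in> borel_measurable borel" for b
    unfolding g_def by measurable
  have "(\<integral>\<^sup>+x. (\<Prod>i\<in>UNIV. f i (x $ i)) \<partial>std_normal_vec)
      = (\<integral>\<^sup>+x. (\<Prod>i\<in>UNIV. f i (x $ i) * ennreal (std_normal_density (x $ i))) \<partial>lborel)"
    unfolding std_normal_vec_def
    by (subst nn_integral_density) (auto simp: prod_ennreal prod.distrib mult.commute)
  also have "\<dots> = (\<integral>\<^sup>+x. (\<Prod>b\<in>Basis. g b (x \<bullet> b)) \<partial>lborel)"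
    by (simp add: ax prod.reindex g_def) (simp add: ax_def inner_axis)
  also have "\<dots> = (\<Prod>b\<in>Basis. \<integral>\<^sup>+t. g b t \<partial>lborel)"
    by (rule nn_integral_lborel_prod) simp_all
  also have "\<dots> = (\<Prod>i\<in>UNIV. \<integral>\<^sup>+t. f i t * ennreal (std_normal_density t) \<partial>lborel)"
    by (simp add: ax prod.reindex g_def)
  finally show ?thesis .
qed

lemma nn_integral_std_normal_density: "(\<integral>\<^sup>+t. ennreal (std_normal_density t) \<partial>lborel) = 1"
proof -
  interpret prob_space "density lborel std_normal_density"
    by (rule prob_space_normal_density) simp
  show ?thesis
    using emeasure_space_1 by (simp add: emeasure_density)
qed

lemma prob_space_std_normal_vec: "prob_space (std_normal_vec :: (real ^ 'n) measure)"
proof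
  have "emeasure std_normal_vec (space (std_normal_vec :: (real ^ 'n) measure))
      = (\<integral>\<^sup>+x. (\<Prod>i\<in>(UNIV::'n set). (\<lambda>i t. 1) i (x $ i)) \<partial>std_normal_vec)"
    by simp
  also have "\<dots> = 1"
    by (subst nn_integral_std_normal_vec_prod) (simp_all add: nn_integral_std_normal_density)
  finally show "emeasure std_normal_vec (space (std_normal_vec :: (real ^ 'n) measure)) = 1" .
qed

lemma nn_integral_std_normal_vec_coordinate:
  fixes h :: "real \<Rightarrow> ennreal" and i :: "'n::finite"
  assumes [measurable]: "h \<in> borel_measurable borel"
  shows "(\<integral>\<^sup>+x. h (x $ i) \<partial>std_normal_vec)
       = (\<integral>\<^sup>+t. h t * ennreal (std_normal_density t) \<partial>lborel)"
proof -
  have "(\<integral>\<^sup>+x. h (x $ i) \<partial>std_normal_vec)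
      = (\<integral>\<^sup>+x. (\<Prod>j\<in>UNIV. (\<lambda>j t. if j = i then h t else 1) j (x $ j)) \<partial>std_normal_vec)"
    by (simp add: prod.delta)
  also have "\<dots> = (\<Prod>j\<in>UNIV. \<integral>\<^sup>+t. (\<lambda>j t. if j = i then h t else 1) j t
                                    * ennreal (std_normal_density t) \<partial>lborel)"
    by (rule nn_integral_std_normal_vec_prod) simp
  also have "\<dots> = (\<Prod>j\<in>UNIV. if j = i then \<integral>\<^sup>+t. h t * ennreal (std_normal_density t) \<partial>lborel else 1)"
    by (intro prod.cong refl) (simp add: nn_integral_std_normal_density)
  also have "\<dots> = (\<integral>\<^sup>+t. h t * ennreal (std_normal_density t) \<partial>lborel)"
    by (simp add: prod.delta)
  finally show ?thesis .
qed

lemma AE_std_normal_vec_coordinate_nonzero: "AE x in std_normal_vec. x $ i \<noteq> 0"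
  for i :: "'n::finite"
proof -
  have "(\<integral>\<^sup>+x. indicator {0::real} (x $ i) \<partial>std_normal_vec)
      = (\<integral>\<^sup>+t. indicator {0::real} t * ennreal (std_normal_density t) \<partial>lborel)"
    by (rule nn_integral_std_normal_vec_coordinate) simp
  also have "\<dots> = 0"
    by (simp add: mult.commute)
  finally have "AE x in std_normal_vec. indicator {0::real} (x $ i) = (0::ennreal)"
    by (subst (asm) nn_integral_0_iff_AE) auto
  then show ?thesis
    by (auto simp: indicator_def split: if_splits)
qed

lemma borel_measurable_linear:
  fixes T :: "'a::euclidean_space \<Rightarrow> 'b::euclidean_space"
  shows "linear T \<Longrightarrow> T \<in> borel_measurable borel"
  by (intro borel_measurable_continuous_onI linear_continuous_on) (simp add: linear_conv_bounded_linear)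

text \<open>
  Both Lebesgue measure and the density, a function of the norm, are invariant under \<open>T\<close>.
\<close>

lemma distr_std_normal_vec_orthogonal:
  fixes T :: "real ^ 'n \<Rightarrow> real ^ 'n"
  assumes T: "orthogonal_transformation T"
  shows "distr std_normal_vec borel T = std_normal_vec"
proof (rule measure_eqI)
  fix B assume "B \<in> sets (distr std_normal_vec borel T)"
  then have B [measurable]: "B \<in> sets borel" by simp
  have T_meas [measurable]: "T \<in> borel_measurable borel"
    using T by (intro borel_measurable_linear orthogonal_transformation_linear)
  let ?p = "\<lambda>x::real ^ 'n. ennreal ((1 / sqrt (2 * pi)) ^ CARD('n) * exp (- (norm x)\<^sup>2 / 2))"
  have "emeasure (distr std_normal_vec borel T) B = (\<integral>\<^sup>+x. ?p (T x) * indicator B (T x) \<partial>lborel)"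
    using measurable_sets[OF T_meas B]
    by (simp add: emeasure_distr std_normal_vec_eq emeasure_density
        orthogonal_transformation_norm[OF T] indicator_vimage)
  also have "\<dots> = emeasure std_normal_vec B"
    by (subst nn_integral_lborel_orthogonal[OF T, of "\<lambda>x. ?p x * indicator B x"])
       (simp_all add: std_normal_vec_eq emeasure_density)
  finally show "emeasure (distr std_normal_vec borel T) B = emeasure std_normal_vec B" .
qed simp

section \<open>Normalised Gaussian vectors and the sphere\<close>

text \<open>
  This writes the radial Gaussian density as a mixture of indicators of balls.
\<close>

lemma nn_integral_exp_tail:
  assumes "s \<ge> 0"
  shows "(\<integral>\<^sup>+t. ennreal (t * exp (- t\<^sup>2 / 2)) * indicator {s<..} t \<partial>lborel)
       = ennreal (exp (- s\<^sup>2 / 2))"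
proof -
  have "(\<integral>\<^sup>+t. ennreal (t * exp (- t\<^sup>2 / 2)) * indicator {s<..} t \<partial>lborel)
      = (\<integral>\<^sup>+t. ennreal (t * exp (- t\<^sup>2 / 2)) * indicator {s..} t \<partial>lborel)"
    using AE_lborel_singleton[of s] by (intro nn_integral_cong_AE) (auto simp: indicator_def)
  also have "\<dots> = ennreal (0 - - exp (- s\<^sup>2 / 2))"
  proof (rule nn_integral_FTC_atLeast)
    show "((\<lambda>t. - exp (- t\<^sup>2 / 2)) \<longlongrightarrow> (0::real)) at_top"
      by real_asymp
  qed (use assms in \<open>auto intro!: derivative_eq_intros\<close>)
  finally show ?thesis by simp
qed

text \<open>
  Written as a mixture of indicators of balls of radius \<open>t\<close>, the Gaussian measure of a cone is an
  integral over \<open>t\<close> of the volume of the part of the cone in the ball of radius \<open>t\<close>, which scales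
  like \<open>t\<close> to the power of the dimension. So Gaussian measure and volume inside the unit ball are
  proportional on cones, and the full space determines the factor \<open>K\<close>.
\<close>

lemma emeasure_std_normal_vec_cone:
  fixes C :: "(real ^ 'n) set"
  assumes C [measurable]: "C \<in> sets borel"
    and cone: "\<And>c x. c > 0 \<Longrightarrow> c *\<^sub>R x \<in> C \<longleftrightarrow> x \<in> C"
  shows "emeasure std_normal_vec C = emeasure (uniform_measure lborel (ball 0 1)) C"
proof -
  define k where "k = ennreal ((1 / sqrt (2 * pi)) ^ CARD('n))"
  define K where "K = k * (\<integral>\<^sup>+t. ennreal (t * exp (- t\<^sup>2 / 2)) * indicator {0<..} t
                                  * ennreal (\<bar>t\<bar> ^ CARD('n)) \<partial>lborel)"
  let ?v = "emeasure lborel (ball (0 :: real ^ 'n) 1)"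
  have radial: "emeasure std_normal_vec D = K * emeasure lborel (D \<inter> ball 0 1)"
    if D [measurable]: "D \<in> sets borel" and cone: "\<And>c x. c > 0 \<Longrightarrow> c *\<^sub>R x \<in> D \<longleftrightarrow> x \<in> D"
    for D :: "(real ^ 'n) set"
  proof -
    have scale: "emeasure lborel (D \<inter> ball 0 t)
        = ennreal (\<bar>t\<bar> ^ CARD('n)) * emeasure lborel (D \<inter> ball 0 1)" if "t > 0" for t
    proof -
      have "emeasure lborel (D \<inter> ball 0 t) = (\<integral>\<^sup>+x. indicator (D \<inter> ball 0 t) x \<partial>lborel)"
        by simp
      also have "\<dots> = ennreal (\<bar>t\<bar> ^ DIM(real ^ 'n))
          * (\<integral>\<^sup>+x. indicator (D \<inter> ball 0 t) (0 + t *\<^sub>R x) \<partial>lborel)"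
        using that by (intro nn_integral_lborel_affine borel_measurable_indicator) auto
      also have "(\<lambda>x. indicator (D \<inter> ball 0 t) (0 + t *\<^sub>R x) :: ennreal) = indicator (D \<inter> ball 0 1)"
        using that by (auto simp: indicator_def fun_eq_iff cone)
      finally show ?thesis by simp
    qed
    have "emeasure std_normal_vec D
        = (\<integral>\<^sup>+x. k * (ennreal (exp (- (norm x)\<^sup>2 / 2)) * indicator D x) \<partial>lborel)"
      by (simp add: std_normal_vec_eq emeasure_density k_def ennreal_mult' mult.assoc)
    also have "\<dots> = k * (\<integral>\<^sup>+x. ennreal (exp (- (norm x)\<^sup>2 / 2)) * indicator D x \<partial>lborel)"
      by (rule nn_integral_cmult) measurable
    also have "(\<integral>\<^sup>+x. ennreal (exp (- (norm x)\<^sup>2 / 2)) * indicator D x \<partial>lborel)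
        = (\<integral>\<^sup>+x. (\<integral>\<^sup>+t. ennreal (t * exp (- t\<^sup>2 / 2)) * indicator {norm x<..} t * indicator D x \<partial>lborel)
            \<partial>lborel)"
    proof (rule nn_integral_cong)
      fix x :: "real ^ 'n"
      show "ennreal (exp (- (norm x)\<^sup>2 / 2)) * indicator D x
          = (\<integral>\<^sup>+t. ennreal (t * exp (- t\<^sup>2 / 2)) * indicator {norm x<..} t * indicator D x \<partial>lborel)"
        using nn_integral_exp_tail[of "norm x"] by (simp add: nn_integral_multc)
    qed
    also have "\<dots> = (\<integral>\<^sup>+t. (\<integral>\<^sup>+x. ennreal (t * exp (- t\<^sup>2 / 2))
                              * indicator {norm x<..} t * indicator D x \<partial>lborel) \<partial>lborel)"
      unfolding indicator_def greaterThan_iff by (rule lborel_pair.Fubini') measurable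
    also have "\<dots> = (\<integral>\<^sup>+t. ennreal (t * exp (- t\<^sup>2 / 2)) * indicator {0<..} t
                            * ennreal (\<bar>t\<bar> ^ CARD('n)) * emeasure lborel (D \<inter> ball 0 1) \<partial>lborel)"
    proof (rule nn_integral_cong)
      fix t :: real
      have "(\<integral>\<^sup>+x. ennreal (t * exp (- t\<^sup>2 / 2)) * indicator {norm x<..} t * indicator D x \<partial>lborel)
          = (\<integral>\<^sup>+x. ennreal (t * exp (- t\<^sup>2 / 2)) * indicator (D \<inter> ball 0 t) x \<partial>lborel)"
        by (rule nn_integral_cong) (auto simp: indicator_def)
      also have "\<dots> = ennreal (t * exp (- t\<^sup>2 / 2)) * emeasure lborel (D \<inter> ball 0 t)"
        by (subst nn_integral_cmult_indicator) auto
      also have "\<dots> = ennreal (t * exp (- t\<^sup>2 / 2)) * indicator {0<..} t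
          * ennreal (\<bar>t\<bar> ^ CARD('n)) * emeasure lborel (D \<inter> ball 0 1)"
        using scale[of t] by (cases "t > 0") (simp_all add: mult.assoc ball_empty not_less)
      finally show "(\<integral>\<^sup>+x. ennreal (t * exp (- t\<^sup>2 / 2)) * indicator {norm x<..} t * indicator D x \<partial>lborel)
          = ennreal (t * exp (- t\<^sup>2 / 2)) * indicator {0<..} t
              * ennreal (\<bar>t\<bar> ^ CARD('n)) * emeasure lborel (D \<inter> ball 0 1)" .
    qed
    finally show ?thesis
      by (simp add: K_def nn_integral_multc mult.assoc[of k])
  qed
  have v: "?v \<noteq> 0" "?v \<noteq> top"
    using emeasure_lborel_ball_finite[of "0 :: real ^ 'n" 1]
    by (auto simp: emeasure_ball unit_ball_vol_def Gamma_real_pos less_imp_neq[symmetric])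
  have "emeasure std_normal_vec (UNIV :: (real ^ 'n) set) = K * emeasure lborel (UNIV \<inter> ball (0 :: real ^ 'n) 1)"
    by (rule radial) auto
  then have "K * ?v = 1"
    using prob_space.emeasure_space_1[OF prob_space_std_normal_vec[where 'n='n]] by simp
  have "emeasure std_normal_vec C = K * emeasure lborel (C \<inter> ball 0 1) * ?v / ?v"
    using v by (simp add: radial[OF C cone] ennreal_mult_divide_eq)
  also have "K * emeasure lborel (C \<inter> ball 0 1) * ?v = K * ?v * emeasure lborel (C \<inter> ball 0 1)"
    by (simp add: mult_ac)
  finally show ?thesis
    using \<open>K * ?v = 1\<close> by (simp add: Int_commute)
qed

text \<open>
  Preimages of Borel sets under the radial projection are cones.
\<close>

lemma distr_std_normal_vec_normalise:
  "distr std_normal_vec borel (\<lambda>x. (r / norm x) *\<^sub>R x) = (unif_sphere r :: (real ^ 'n) measure)"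
proof (rule measure_eqI)
  let ?\<rho> = "\<lambda>x :: real ^ 'n. (r / norm x) *\<^sub>R x"
  fix B :: "(real ^ 'n) set" assume "B \<in> sets (distr std_normal_vec borel ?\<rho>)"
  then have B [measurable]: "B \<in> sets borel" by simp
  have \<rho> [measurable]: "?\<rho> \<in> borel_measurable borel" by measurable
  have "emeasure std_normal_vec (?\<rho> -` B) = emeasure (uniform_measure lborel (ball 0 1)) (?\<rho> -` B)"
    using measurable_sets[OF \<rho> B] by (intro emeasure_std_normal_vec_cone) auto
  then show "emeasure (distr std_normal_vec borel ?\<rho>) B = emeasure (unif_sphere r) B"
    unfolding unif_sphere_def by (simp add: emeasure_distr)
qed (simp add: unif_sphere_def)

text \<open>
  For functions that are homogeneous of degree 0, both laws of the theorem give the same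
  expectation, so all further computations can be done with independent Gaussian coordinates.
\<close>

lemma homogeneous_integral_eq_gaussian:
  fixes G :: "real ^ 'n \<Rightarrow> 'b::{banach, second_countable_topology}"
  assumes X [measurable]: "X \<in> borel_measurable P"
    and law: "distr P borel X = std_normal_vec \<or> distr P borel X = unif_sphere r"
    and r: "r > 0"
    and G [measurable]: "G \<in> borel_measurable borel"
    and homogeneous: "\<And>c x. c > 0 \<Longrightarrow> G (c *\<^sub>R x) = G x"
  shows "integrable P (\<lambda>\<omega>. G (X \<omega>)) \<longleftrightarrow> integrable std_normal_vec G"
    and "(\<integral>\<omega>. G (X \<omega>) \<partial>P) = (\<integral>x. G x \<partial>std_normal_vec)"
proof -
  have G_normalise: "G ((r / norm x) *\<^sub>R x) = G x" for x
    using homogeneous[of "r / norm x" x] r by (cases "x = 0") auto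
  have "integrable (unif_sphere r) G \<longleftrightarrow> integrable std_normal_vec G"
    and "integral\<^sup>L (unif_sphere r) G = integral\<^sup>L std_normal_vec G"
    unfolding distr_std_normal_vec_normalise[symmetric]
    by (simp_all add: integrable_distr_eq integral_distr G_normalise)
  then have "integrable (distr P borel X) G \<longleftrightarrow> integrable std_normal_vec G"
    and "integral\<^sup>L (distr P borel X) G = integral\<^sup>L std_normal_vec G"
    using law by (elim disjE; simp)+
  then show "integrable P (\<lambda>\<omega>. G (X \<omega>)) \<longleftrightarrow> integrable std_normal_vec G"
    and "(\<integral>\<omega>. G (X \<omega>) \<partial>P) = (\<integral>x. G x \<partial>std_normal_vec)"
    by (simp_all add: integrable_distr_eq integral_distr)
qed

section \<open>Absolute moments of the normal distribution\<close>

text \<open>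
  The substitution \<open>u = t\<^sup>2 / 2\<close> in Euler's integral for \<open>Gamma ((a + 1) / 2)\<close>.
\<close>

lemma nn_integral_half_gaussian_moment:
  assumes "a > -1"
  shows "(\<integral>\<^sup>+t. ennreal (indicator {0<..} t * (t powr a * exp (- t\<^sup>2 / 2))) \<partial>lborel)
       = ennreal (2 powr ((a - 1) / 2) * Gamma ((a + 1) / 2))"
proof -
  define s where "s = (a + 1) / 2"
  have s: "s > 0" using assms by (simp add: s_def)
  let ?f = "\<lambda>u::real. u powr (s - 1) / exp u"
  have "((\<lambda>u. if u \<in> {0<..} then ?f u else 0) has_integral Gamma s) {0..}"
    using Gamma_integral_real[OF s] by (rule has_integral_spike[of "{0}", rotated 2]) auto
  then have f: "(?f has_integral Gamma s) {0<..}"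
    by (subst (asm) has_integral_restrict) auto
  then have f_abs: "?f absolutely_integrable_on {0<..}"
    by (intro nonnegative_absolutely_integrable_1) (auto simp: has_integral_iff)
  let ?g = "\<lambda>t::real. t\<^sup>2 / 2"
  have img: "?g ` {0<..} = {0<..}"
  proof safe
    fix u :: real assume "u > 0"
    then show "u \<in> ?g ` {0<..}"
      by (intro image_eqI[of _ _ "sqrt (2 * u)"]) auto
  qed auto
  have "(\<lambda>t. \<bar>t\<bar> * ?f (?g t)) absolutely_integrable_on {0<..} \<and>
        integral {0<..} (\<lambda>t. \<bar>t\<bar> * ?f (?g t)) = Gamma s
    \<longleftrightarrow> ?f absolutely_integrable_on ?g ` {0<..} \<and> integral (?g ` {0<..}) ?f = Gamma s"
    by (rule has_absolute_integral_change_of_variables_1')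
       (auto intro!: derivative_eq_intros simp: inj_on_def power2_eq_iff)
  then have "(\<lambda>t. \<bar>t\<bar> * ?f (?g t)) absolutely_integrable_on {0<..} \<and>
        integral {0<..} (\<lambda>t. \<bar>t\<bar> * ?f (?g t)) = Gamma s"
    unfolding img using f f_abs by (auto simp: has_integral_iff)
  then have "((\<lambda>t. \<bar>t\<bar> * ?f (?g t)) has_integral Gamma s) {0<..}"
    by (auto simp: has_integral_iff set_lebesgue_integral_eq_integral(1))
  then have "((\<lambda>t. 2 powr ((a - 1) / 2) * (\<bar>t\<bar> * ?f (?g t)))
        has_integral 2 powr ((a - 1) / 2) * Gamma s) {0<..}"
    by (rule has_integral_mult_right)
  then have "((\<lambda>t. t powr a * exp (- t\<^sup>2 / 2)) has_integral 2 powr ((a - 1) / 2) * Gamma s) {0<..}"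
  proof (rule has_integral_eq[rotated])
    fix t :: real assume "t \<in> {0<..}"
    then have t: "t > 0" by simp
    have "(t\<^sup>2 / 2) powr (s - 1) = (t powr 2) powr (s - 1) / 2 powr (s - 1)"
      using t by (simp add: powr_divide)
    also have "\<dots> = t powr (a - 1) / 2 powr ((a - 1) / 2)"
    proof -
      have "2 * (s - 1) = a - 1" "s - 1 = (a - 1) / 2"
        by (simp_all add: s_def field_simps)
      then show ?thesis
        by (simp only: powr_powr)
    qed
    finally have "2 powr ((a - 1) / 2) * (t * (t\<^sup>2 / 2) powr (s - 1)) = t * t powr (a - 1)"
      by simp
    also have "\<dots> = t powr a"
      using t powr_mult_base[of t "a - 1"] by simp
    finally have subst: "2 powr ((a - 1) / 2) * (t * (t\<^sup>2 / 2) powr (s - 1)) = t powr a" .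
    have "2 powr ((a - 1) / 2) * (\<bar>t\<bar> * ?f (?g t))
        = 2 powr ((a - 1) / 2) * (t * (t\<^sup>2 / 2) powr (s - 1)) * exp (- t\<^sup>2 / 2)"
    proof -
      have "exp (- t\<^sup>2 / 2) = 1 / exp (t\<^sup>2 / 2)"
        by (simp add: exp_minus inverse_eq_divide)
      then show ?thesis
        using t by (simp only:) simp
    qed
    then show "2 powr ((a - 1) / 2) * (\<bar>t\<bar> * ?f (?g t)) = t powr a * exp (- t\<^sup>2 / 2)"
      unfolding subst .
  qed
  then show ?thesis
    using nn_integral_has_integral_lebesgue[of "{0<..}" "\<lambda>t. t powr a * exp (- t\<^sup>2 / 2)"]
    by (simp add: s_def)
qed

lemma nn_integral_gaussian_abs_moment:
  assumes "a > -1"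
  shows "(\<integral>\<^sup>+t. ennreal (\<bar>t\<bar> powr a) * ennreal (std_normal_density t) \<partial>lborel)
       = ennreal (2 powr (a / 2) * Gamma ((a + 1) / 2) / sqrt pi)"
proof -
  define h where "h t = ennreal (indicator {0<..} t * (t powr a * exp (- t\<^sup>2 / 2)))" for t :: real
  have [measurable]: "h \<in> borel_measurable borel"
    unfolding h_def by measurable
  \<comment> \<open>At \<open>t = 0\<close> both sides vanish for every \<open>a\<close>, since \<open>0 powr a = 0\<close>.\<close>
  have "ennreal (\<bar>t\<bar> powr a) * ennreal (std_normal_density t)
      = ennreal (1 / sqrt (2 * pi)) * (h t + h (- t))" for t
    by (cases t "0::real" rule: linorder_cases)
       (simp_all add: h_def std_normal_density_def ennreal_mult'[symmetric] mult_ac)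
  then have "(\<integral>\<^sup>+t. ennreal (\<bar>t\<bar> powr a) * ennreal (std_normal_density t) \<partial>lborel)
      = ennreal (1 / sqrt (2 * pi)) * ((\<integral>\<^sup>+t. h t \<partial>lborel) + (\<integral>\<^sup>+t. h (- t) \<partial>lborel))"
    by (simp add: nn_integral_cmult nn_integral_add)
  also have "(\<integral>\<^sup>+t. h (- t) \<partial>lborel) = (\<integral>\<^sup>+t. h t \<partial>lborel)"
    using nn_integral_real_affine[of h "-1" 0] by simp
  also have "(\<integral>\<^sup>+t. h t \<partial>lborel) = ennreal (2 powr ((a - 1) / 2) * Gamma ((a + 1) / 2))"
    unfolding h_def by (rule nn_integral_half_gaussian_moment[OF assms])
  also have "ennreal (1 / sqrt (2 * pi))
        * (ennreal (2 powr ((a - 1) / 2) * Gamma ((a + 1) / 2))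
           + ennreal (2 powr ((a - 1) / 2) * Gamma ((a + 1) / 2)))
      = ennreal (1 / sqrt (2 * pi) * (2 * (2 powr ((a - 1) / 2) * Gamma ((a + 1) / 2))))"
  proof -
    have "ennreal k * (ennreal c + ennreal c) = ennreal (k * (2 * c))" if "k \<ge> 0" "c \<ge> 0" for k c
      using that by (simp add: ennreal_mult' ennreal_plus[symmetric] del: ennreal_plus)
    then show ?thesis
      using assms by (simp add: Gamma_real_pos less_imp_le)
  qed
  also have "1 / sqrt (2 * pi) * (2 * (2 powr ((a - 1) / 2) * Gamma ((a + 1) / 2)))
      = 2 powr (a / 2) * Gamma ((a + 1) / 2) / sqrt pi"
  proof -
    have "2 * 2 powr ((a - 1) / 2) = 2 powr 1 * 2 powr ((a - 1) / 2)" by simp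
    also have "\<dots> = sqrt 2 * 2 powr (a / 2)"
      by (simp only: powr_half_sqrt[symmetric] powr_add[symmetric]) (simp add: field_simps)
    finally show ?thesis
      by (simp add: real_sqrt_mult field_simps)
  qed
  finally show ?thesis .
qed

section \<open>Bounds for Gaussian quotients\<close>

lemma Gamma_add_one_pos: "x > 0 \<Longrightarrow> Gamma (x + 1) = x * Gamma x" for x :: real
  using Gamma_plus1[of x] nonpos_Ints_nonpos[of x] by force

lemma Gamma_three_halves: "Gamma (3 / 2 :: real) = sqrt pi / 2"
  using Gamma_add_one_pos[of "1 / 2"] by (simp add: Gamma_one_half_real)

text \<open>
  The ratio decreases when \<open>n\<close> grows by 2, because \<open>Gamma (x + 1) = x * Gamma x\<close> multiplies it by
  \<open>n / (n + 1)\<close>; so only \<open>n = 2\<close> and \<open>n = 3\<close> have to be checked, and there the bound follows from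
  \<open>pi \<le> 4\<close>.
\<close>

lemma Gamma_half_ratio_le:
  assumes "n \<ge> 2"
  shows "Gamma (real n / 2) / Gamma ((real n + 1) / 2) \<le> 4 / pi"
  using assms
proof (induction n rule: less_induct)
  case (less n)
  have sqrt_pi: "sqrt pi \<le> 2"
    using pi_less_4 by (intro real_le_lsqrt) auto
  have Gamma_2: "Gamma (2 :: real) = 1"
    using Gamma_add_one_pos[of 1] by simp
  consider "n = 2" | "n = 3" | m where "m \<ge> 2" "n = m + 2"
    using less.prems by (metis One_nat_def Suc_1 add_2_eq_Suc' le_Suc_ex le_antisym not_less_eq_eq numeral_3_eq_3 add.commute)
  then show ?case
  proof cases
    case 1
    have "2 / sqrt pi = 2 * sqrt pi / pi"
      by (metis divide_divide_eq_right mult.commute pi_ge_zero real_div_sqrt times_divide_eq_right)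
    also have "\<dots> \<le> 4 / pi"
      using sqrt_pi by (intro divide_right_mono) auto
    finally show ?thesis
      using 1 by (simp add: Gamma_three_halves)
  next
    case 2
    have "sqrt pi * pi \<le> 2 * 4"
      using sqrt_pi pi_less_4 by (intro mult_mono) auto
    then show ?thesis
      using 2 by (simp add: Gamma_three_halves Gamma_2 field_simps)
  next
    case (3 m)
    let ?x = "real m / 2"
    have pos: "Gamma ?x > 0" "Gamma (?x + 1 / 2) > 0" "?x > 0"
      using 3 by (auto intro!: Gamma_real_pos)
    have "Gamma (real n / 2) / Gamma ((real n + 1) / 2)
        = Gamma (?x + 1) / Gamma (?x + 1 / 2 + 1)"
      using 3 by (simp add: add_divide_distrib add_ac)
    also have "\<dots> = (?x * Gamma ?x) / ((?x + 1 / 2) * Gamma (?x + 1 / 2))"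
      using pos by (subst (1 2) Gamma_add_one_pos) auto
    also have "\<dots> = ?x / (?x + 1 / 2) * (Gamma ?x / Gamma (?x + 1 / 2))"
      by simp
    also have "\<dots> \<le> 1 * (Gamma ?x / Gamma (?x + 1 / 2))"
      using pos by (intro mult_right_mono) auto
    also have "\<dots> = Gamma (real m / 2) / Gamma ((real m + 1) / 2)"
      by (simp add: add_divide_distrib)
    also have "\<dots> \<le> 4 / pi"
      using 3 by (intro less.IH) auto
    finally show ?thesis .
  qed
qed

lemma nn_integral_std_normal_vec_abs: "(\<integral>\<^sup>+x. ennreal \<bar>x $ i\<bar> \<partial>std_normal_vec) = ennreal (sqrt (2 / pi))"
  for i :: "'n::finite"
proof -
  have "(\<integral>\<^sup>+x. ennreal \<bar>x $ i\<bar> \<partial>std_normal_vec)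
      = (\<integral>\<^sup>+t. ennreal (\<bar>t\<bar> powr 1) * ennreal (std_normal_density t) \<partial>lborel)"
    by (subst nn_integral_std_normal_vec_coordinate) auto
  then show ?thesis
    by (subst (asm) nn_integral_gaussian_abs_moment) (auto simp: powr_half_sqrt real_sqrt_divide)
qed

lemma nn_integral_std_normal_vec_square: "(\<integral>\<^sup>+x. ennreal ((x $ i)\<^sup>2) \<partial>std_normal_vec) = 1"
  for i :: "'n::finite"
proof -
  have "(\<integral>\<^sup>+x. ennreal ((x $ i)\<^sup>2) \<partial>std_normal_vec)
      = (\<integral>\<^sup>+t. ennreal (\<bar>t\<bar> powr 2) * ennreal (std_normal_density t) \<partial>lborel)"
    by (subst nn_integral_std_normal_vec_coordinate) auto
  also have "\<dots> = ennreal (2 * Gamma (3 / 2) / sqrt pi)"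
    by (subst nn_integral_gaussian_abs_moment) auto
  also have "2 * Gamma (3 / 2) / sqrt pi = 1"
    by (simp add: Gamma_three_halves)
  finally show ?thesis by simp
qed

text \<open>
  With \<open>y = x $ i\<close>, the Cauchy-Schwarz inequality gives \<open>(E \<bar>y\<bar>)\<^sup>2 \<le> E (y\<^sup>2 / Q) * E Q\<close>, where
  \<open>E \<bar>y\<bar> = sqrt (2 / pi)\<close> and \<open>E Q\<close> is the sum of the \<open>l j\<close>. It is used in its linearised form
  \<open>2 * c * \<bar>y\<bar> \<le> y\<^sup>2 / Q + c\<^sup>2 * Q\<close> with the optimal constant \<open>c = E \<bar>y\<bar> / E Q\<close>.
\<close>

lemma gaussian_quotient_lower_bound:
  fixes l :: "'n::finite \<Rightarrow> real"
  assumes l: "\<And>j. l j \<ge> 0" and s: "(\<Sum>j\<in>UNIV. l j) > 0"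
  shows "ennreal (2 / (pi * (\<Sum>j\<in>UNIV. l j)))
       \<le> (\<integral>\<^sup>+x. ennreal ((x $ i)\<^sup>2 / (\<Sum>j\<in>UNIV. l j * (x $ j)\<^sup>2)) \<partial>std_normal_vec)"
proof -
  define s where "s = (\<Sum>j\<in>UNIV. l j)"
  define c where "c = sqrt (2 / pi) / s"
  define Q where "Q x = (\<Sum>j\<in>UNIV. l j * (x $ j)\<^sup>2)" for x :: "real ^ 'n"
  let ?I = "\<integral>\<^sup>+x. ennreal ((x $ i)\<^sup>2 / Q x) \<partial>std_normal_vec"
  have "s > 0" using assms by (simp add: s_def)
  then have c: "c > 0" by (simp add: c_def)
  have Q_nonneg: "Q x \<ge> 0" for x
    unfolding Q_def using l by (intro sum_nonneg) auto
  have [measurable]: "Q \<in> borel_measurable borel"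
    unfolding Q_def by measurable
  obtain k where k: "l k > 0"
    using s l by (metis less_eq_real_def not_less sum_nonpos)
  have int_Q: "(\<integral>\<^sup>+x. ennreal (Q x) \<partial>std_normal_vec) = ennreal s"
  proof -
    have "(\<integral>\<^sup>+x. ennreal (Q x) \<partial>std_normal_vec)
        = (\<integral>\<^sup>+x. (\<Sum>j\<in>UNIV. ennreal (l j) * ennreal ((x $ j)\<^sup>2)) \<partial>std_normal_vec)"
      unfolding Q_def using l by (simp add: sum_ennreal ennreal_mult[symmetric])
    also have "\<dots> = (\<Sum>j\<in>UNIV. ennreal (l j))"
      by (simp add: nn_integral_sum nn_integral_cmult nn_integral_std_normal_vec_square)
    finally show ?thesis
      using l by (simp add: s_def sum_ennreal)
  qed
  have "ennreal (2 * c * sqrt (2 / pi)) = (\<integral>\<^sup>+x. ennreal (2 * c) * ennreal \<bar>x $ i\<bar> \<partial>std_normal_vec)"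
    using c by (simp add: nn_integral_cmult nn_integral_std_normal_vec_abs ennreal_mult)
  also have "\<dots> \<le> (\<integral>\<^sup>+x. ennreal ((x $ i)\<^sup>2 / Q x) + ennreal (c\<^sup>2) * ennreal (Q x) \<partial>std_normal_vec)"
  proof (rule nn_integral_mono_AE)
    have pointwise: "2 * c * \<bar>x $ i\<bar> \<le> (x $ i)\<^sup>2 / Q x + c\<^sup>2 * Q x" if "x $ k \<noteq> 0" for x
    proof -
      have "l k * (x $ k)\<^sup>2 \<le> Q x"
        unfolding Q_def using l by (intro member_le_sum) auto
      then have Q: "Q x > 0"
        using k that by (smt (verit) mult_pos_pos zero_less_power2)
      have "0 \<le> (\<bar>x $ i\<bar> - c * Q x)\<^sup>2 / Q x"
        using Q by simp
      also have "\<dots> = (x $ i)\<^sup>2 / Q x + c\<^sup>2 * Q x - 2 * c * \<bar>x $ i\<bar>"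
        using Q by (simp add: power2_diff power_mult_distrib field_simps power2_eq_square)
      finally show ?thesis by simp
    qed
    show "AE x in std_normal_vec. ennreal (2 * c) * ennreal \<bar>x $ i\<bar>
        \<le> ennreal ((x $ i)\<^sup>2 / Q x) + ennreal (c\<^sup>2) * ennreal (Q x)"
      using AE_std_normal_vec_coordinate_nonzero[of k]
    proof (rule AE_mp, intro AE_I2 impI)
      fix x :: "real ^ 'n" assume "x $ k \<noteq> 0"
      then have "ennreal (2 * c * \<bar>x $ i\<bar>) \<le> ennreal ((x $ i)\<^sup>2 / Q x + c\<^sup>2 * Q x)"
        by (intro ennreal_leI pointwise)
      then show "ennreal (2 * c) * ennreal \<bar>x $ i\<bar>
          \<le> ennreal ((x $ i)\<^sup>2 / Q x) + ennreal (c\<^sup>2) * ennreal (Q x)"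
        using c Q_nonneg by (simp add: ennreal_mult)
    qed
  qed
  also have "\<dots> = ?I + ennreal (c\<^sup>2) * ennreal s"
    by (simp add: nn_integral_add nn_integral_cmult int_Q)
  finally have *: "ennreal (2 * c * sqrt (2 / pi)) \<le> ?I + ennreal (c\<^sup>2 * s)"
    using \<open>s > 0\<close> by (simp add: ennreal_mult)
  have c_sqrt: "c * sqrt (2 / pi) = 2 / (pi * s)" and c_sq: "c\<^sup>2 * s = 2 / (pi * s)"
    using \<open>s > 0\<close> by (simp_all add: c_def power2_eq_square)
  have "ennreal (2 / (pi * s)) \<le> ?I"
  proof (cases ?I)
    case (real r)
    then have "ennreal (2 * c * sqrt (2 / pi)) \<le> ennreal (r + c\<^sup>2 * s)"
      using * \<open>s > 0\<close> by simp
    then have "2 * c * sqrt (2 / pi) \<le> r + c\<^sup>2 * s"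
      using real \<open>s > 0\<close> by (subst (asm) ennreal_le_iff) auto
    then show ?thesis
      using real c_sqrt c_sq by (simp add: ennreal_leI mult.assoc)
  qed simp
  then show ?thesis
    unfolding s_def Q_def .
qed

text \<open>
  The inequality of arithmetic and geometric means bounds the denominator from below by \<open>d\<close> times
  the geometric mean of the \<open>l j * (x $ j)\<^sup>2\<close>. What remains is a product of powers of the
  coordinates with exponent \<open>2 - 2 / d\<close> at \<open>i\<close> and \<open>- 2 / d\<close> elsewhere, whose expectation
  factorises into absolute moments. The exponents sum to 0, so the powers of 2 in these moments
  cancel; \<open>d > 2\<close> makes the exponent \<open>- 2 / d\<close> integrable at the origin.
\<close>

lemma gaussian_quotient_upper_bound:
  fixes l :: "'n::finite \<Rightarrow> real"
  assumes l: "\<And>j. l j > 0" and d: "CARD('n) > 2"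
  shows "(\<integral>\<^sup>+x. ennreal ((x $ i)\<^sup>2 / (\<Sum>j\<in>UNIV. l j * (x $ j)\<^sup>2)) \<partial>std_normal_vec)
       \<le> ennreal (1 / (real CARD('n) * (\<Prod>j\<in>UNIV. l j) powr (1 / real CARD('n)))
            * (1 / pi powr (real CARD('n) / 2))
            * Gamma (3 / 2 - 1 / real CARD('n))
            * Gamma (1 / 2 - 1 / real CARD('n)) ^ (CARD('n) - 1))"
proof -
  define d where "d = real CARD('n)"
  have d2: "d > 2" using d by (simp add: d_def)
  define K where "K = 1 / (d * (\<Prod>j\<in>UNIV. l j) powr (1 / d))"
  have K: "K > 0"
    using l d2 by (simp add: K_def prod_pos less_imp_neq[symmetric])
  define e where "e j = (if j = i then 2 else 0) - 2 / d" for j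
  define m where "m a = 2 powr (a / 2) * Gamma ((a + 1) / 2) / sqrt pi" for a :: real
  have e: "e j > -1" for j
    using d2 by (simp add: e_def field_simps)
  have m_nonneg: "m (e j) \<ge> 0" for j
    using e[of j] by (simp add: m_def Gamma_real_pos less_imp_le)
  define Q where "Q x = (\<Sum>j\<in>UNIV. l j * (x $ j)\<^sup>2)" for x :: "real ^ 'n"
  have pointwise: "(x $ i)\<^sup>2 / Q x \<le> K * (\<Prod>j\<in>UNIV. \<bar>x $ j\<bar> powr e j)"
    if x: "\<And>j. x $ j \<noteq> 0" for x
  proof -
    define G where "G = (\<Prod>j\<in>UNIV. \<bar>x $ j\<bar> powr (2 / d))"
    have G: "G > 0" unfolding G_def using x by (intro prod_pos) auto
    have "(\<Prod>j\<in>UNIV. l j * (x $ j)\<^sup>2) powr (1 / d) = (\<Prod>j\<in>UNIV. l j) powr (1 / d) * G"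
    proof -
      have "((x $ j)\<^sup>2) powr (1 / d) = \<bar>x $ j\<bar> powr (2 / d)" for j
        using x[of j] powr_powr[of "\<bar>x $ j\<bar>" 2 "1 / d"] by simp
      then show ?thesis
        using l by (simp add: prod_powr_distrib powr_mult less_imp_le prod.distrib prod_nonneg G_def)
    qed
    moreover have "(\<Prod>j\<in>UNIV. l j * (x $ j)\<^sup>2) powr (1 / d) \<le> Q x / d"
      using arith_geom_mean[of "UNIV :: 'n set" "\<lambda>j. l j * (x $ j)\<^sup>2"] l
      by (simp add: d_def Q_def sum_divide_distrib less_imp_le)
    ultimately have Q_ge: "1 / K * G \<le> Q x"
      using d2 by (simp add: K_def field_simps)
    have KG: "1 / K * G > 0" using K G by simp
    have "(x $ i)\<^sup>2 / Q x \<le> (x $ i)\<^sup>2 / (1 / K * G)"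
      using order.strict_trans2[OF KG Q_ge] by (intro divide_left_mono Q_ge KG mult_pos_pos) auto
    also have "\<dots> = K * ((x $ i)\<^sup>2 / G)"
      by simp
    also have "(x $ i)\<^sup>2 / G = (\<Prod>j\<in>UNIV. \<bar>x $ j\<bar> powr e j)"
    proof -
      have "\<bar>x $ j\<bar> powr e j = (if j = i then (x $ j)\<^sup>2 else 1) / \<bar>x $ j\<bar> powr (2 / d)" for j
        using x[of j] by (simp add: e_def powr_diff powr_minus_divide)
      then show ?thesis
        by (simp add: prod_dividef G_def prod.delta)
    qed
    finally show ?thesis .
  qed
  have "(\<integral>\<^sup>+x. ennreal ((x $ i)\<^sup>2 / Q x) \<partial>std_normal_vec)
      \<le> (\<integral>\<^sup>+x. ennreal K * (\<Prod>j\<in>UNIV. ennreal (\<bar>x $ j\<bar> powr e j)) \<partial>std_normal_vec)"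
  proof (rule nn_integral_mono_AE)
    have "AE x in (std_normal_vec :: (real ^ 'n) measure). \<forall>j. x $ j \<noteq> 0"
      using AE_std_normal_vec_coordinate_nonzero by (subst AE_all_countable) auto
    then show "AE x in std_normal_vec. ennreal ((x $ i)\<^sup>2 / Q x)
        \<le> ennreal K * (\<Prod>j\<in>UNIV. ennreal (\<bar>x $ j\<bar> powr e j))"
    proof (rule AE_mp, intro AE_I2 impI)
      fix x :: "real ^ 'n" assume "\<forall>j. x $ j \<noteq> 0"
      then have "ennreal ((x $ i)\<^sup>2 / Q x) \<le> ennreal (K * (\<Prod>j\<in>UNIV. \<bar>x $ j\<bar> powr e j))"
        by (intro ennreal_leI pointwise) auto
      then show "ennreal ((x $ i)\<^sup>2 / Q x) \<le> ennreal K * (\<Prod>j\<in>UNIV. ennreal (\<bar>x $ j\<bar> powr e j))"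
        using K by (simp add: ennreal_mult prod_ennreal prod_nonneg)
    qed
  qed
  also have "\<dots> = ennreal K * (\<integral>\<^sup>+x. (\<Prod>j\<in>UNIV. ennreal (\<bar>x $ j\<bar> powr e j)) \<partial>std_normal_vec)"
    by (rule nn_integral_cmult) measurable
  also have "(\<integral>\<^sup>+x. (\<Prod>j\<in>UNIV. ennreal (\<bar>x $ j\<bar> powr e j)) \<partial>std_normal_vec)
      = (\<Prod>j\<in>UNIV. ennreal (m (e j)))"
    by (subst nn_integral_std_normal_vec_prod[of "\<lambda>j t. ennreal (\<bar>t\<bar> powr e j)"])
       (simp_all add: nn_integral_gaussian_abs_moment[OF e] m_def)
  also have "\<dots> = ennreal (\<Prod>j\<in>UNIV. m (e j))"
    using m_nonneg by (rule prod_ennreal)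
  also have "ennreal K * \<dots> = ennreal (K * (\<Prod>j\<in>UNIV. m (e j)))"
    using K m_nonneg by (simp add: ennreal_mult prod_nonneg)
  also have "(\<Prod>j\<in>UNIV. m (e j))
      = 1 / pi powr (d / 2) * Gamma (3 / 2 - 1 / d) * Gamma (1 / 2 - 1 / d) ^ (CARD('n) - 1)"
  proof -
    \<comment> \<open>The factors \<open>2 powr (e j / 2)\<close> of the moments multiply to 1.\<close>
    have "(\<Sum>j\<in>UNIV. e j / 2) = 0"
      using d2 by (simp add: e_def sum_divide_distrib[symmetric] sum_subtractf sum.delta d_def)
    then have "(\<Prod>j\<in>UNIV. 2 powr (e j / 2)) = (1::real)"
      by (simp add: powr_sum[symmetric])
    moreover have "(\<Prod>j\<in>UNIV. Gamma ((e j + 1) / 2))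
        = Gamma (3 / 2 - 1 / d) * Gamma (1 / 2 - 1 / d) ^ (CARD('n) - 1)"
    proof -
      have "Gamma ((e i + 1) / 2) = Gamma (3 / 2 - 1 / d)"
        by (simp add: e_def diff_divide_distrib add_divide_distrib)
      moreover have "(\<Prod>j\<in>UNIV - {i}. Gamma ((e j + 1) / 2)) = (\<Prod>j\<in>UNIV - {i}. Gamma (1 / 2 - 1 / d))"
        by (intro prod.cong refl) (auto simp: e_def diff_divide_distrib add_divide_distrib)
      ultimately show ?thesis
        by (simp add: prod.remove[of UNIV i] card_Diff_singleton)
    qed
    moreover have "sqrt pi ^ CARD('n) = pi powr (d / 2)"
      by (simp add: powr_half_sqrt[symmetric] powr_power d_def)
    ultimately show ?thesis
      by (simp add: m_def prod_dividef prod.distrib)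
  qed
  finally show ?thesis
    by (simp add: K_def Q_def d_def mult.assoc)
qed

section \<open>Simultaneous diagonalisation\<close>

lemma orthogonal_matrix_imp_transformation:
  "orthogonal_matrix U \<Longrightarrow> orthogonal_transformation ((*v) U)" for U :: "real ^ 'n ^ 'n"
  by (simp add: orthogonal_transformation_matrix)

lemma orthogonal_matrix_columns:
  assumes "orthogonal_matrix U"
  shows "column j U \<bullet> (U *v x) = x $ j"
proof -
  have "column j U \<bullet> (U *v x) = (transpose U *v (U *v x)) $ j"
    by (simp add: matrix_vector_mult_def transpose_def column_def inner_vec_def)
  also have "transpose U *v (U *v x) = x"
    using assms by (simp add: matrix_vector_mul_assoc orthogonal_matrix)
  finally show ?thesis .
qed

lemma norm_square_diagonalized:
  fixes A :: "real ^ 'd ^ 'm"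
  assumes U: "orthogonal_matrix U" and S: "transpose A ** A = U ** diag_matrix lam ** transpose U"
  shows "(norm (A *v x))\<^sup>2 = (\<Sum>j\<in>UNIV. lam $ j * (column j U \<bullet> x)\<^sup>2)"
proof -
  define y where "y = transpose U *v x"
  have y: "y $ j = column j U \<bullet> x" for j
    by (simp add: y_def matrix_vector_mult_def transpose_def column_def inner_vec_def)
  have "(norm (A *v x))\<^sup>2 = x \<bullet> ((transpose A ** A) *v x)"
    by (simp add: power2_norm_eq_inner dot_lmul_matrix[symmetric] vector_transpose_matrix
        matrix_vector_mul_assoc[symmetric] inner_commute)
  also have "\<dots> = x \<bullet> (U *v (diag_matrix lam *v y))"
    unfolding S y_def by (simp only: matrix_vector_mul_assoc matrix_mul_assoc)
  also have "\<dots> = y \<bullet> (diag_matrix lam *v y)"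
    by (simp add: y_def dot_lmul_matrix[symmetric])
  also have "\<dots> = (\<Sum>j\<in>UNIV. lam $ j * (y $ j)\<^sup>2)"
  proof -
    have "(diag_matrix lam *v y) $ j = lam $ j * y $ j" for j
      by (simp add: diag_matrix_def matrix_vector_mult_def if_distrib[of "\<lambda>a. a * _"] cong: if_cong)
    then show ?thesis
      by (simp add: inner_vec_def power2_eq_square mult_ac)
  qed
  finally show ?thesis by (simp add: y)
qed

lemma outer_matrix_vector: "outer (U *v x) = U ** outer x ** transpose U"
  by (simp add: outer_def vec_eq_iff matrix_matrix_mult_def matrix_vector_mult_def transpose_def
      sum_distrib_left sum_distrib_right mult_ac)

text \<open>
  This lets the expectation commute with multiplication by fixed matrices.
\<close>

lemma bounded_linear_matrix_conj:
  fixes U :: "real ^ 'n ^ 'm" and V :: "real ^ 'l ^ 'k"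
  shows "bounded_linear (\<lambda>S :: real ^ 'k ^ 'n. U ** S ** V)"
proof -
  have "linear (\<lambda>S :: real ^ 'k ^ 'n. U ** S ** V)"
    by (intro linearI)
       (simp_all add: vec_eq_iff matrix_matrix_mult_def sum_distrib_left sum_distrib_right
          sum.distrib algebra_simps)
  then show ?thesis by (simp add: linear_conv_bounded_linear)
qed

text \<open>
  Flipping the sign of the coordinate \<open>i\<close> preserves the Gaussian law and \<open>Q\<close> but negates the
  integrand.
\<close>

lemma gaussian_sign_symmetry:
  fixes Q :: "real ^ 'n \<Rightarrow> real"
  assumes Q [measurable]: "Q \<in> borel_measurable borel"
    and even: "\<And>x y. (\<And>k. (y $ k)\<^sup>2 = (x $ k)\<^sup>2) \<Longrightarrow> Q y = Q x" and "i \<noteq> j"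
  shows "(\<integral>x. x $ i * x $ j / Q x \<partial>std_normal_vec) = 0"
proof -
  define F where "F x = (\<chi> k. if k = i then - x $ k else x $ k)" for x :: "real ^ 'n"
  have F: "orthogonal_transformation F"
    unfolding orthogonal_transformation
  proof (intro conjI allI)
    show "linear F" by (intro linearI) (auto simp: F_def vec_eq_iff)
    show "norm (F x) = norm x" for x
      unfolding norm_vec_def L2_set_def
      by (intro arg_cong[of _ _ sqrt] sum.cong) (auto simp: F_def)
  qed
  have [measurable]: "F \<in> borel_measurable borel"
    using F by (intro borel_measurable_linear orthogonal_transformation_linear)
  let ?I = "\<integral>x. x $ i * x $ j / Q x \<partial>std_normal_vec"
  have "?I = (\<integral>x. x $ i * x $ j / Q x \<partial>distr std_normal_vec borel F)"
    by (simp add: distr_std_normal_vec_orthogonal[OF F])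
  also have "\<dots> = (\<integral>x. F x $ i * F x $ j / Q (F x) \<partial>std_normal_vec)"
    by (rule integral_distr) measurable
  also have "\<dots> = (\<integral>x. - (x $ i * x $ j / Q x) \<partial>std_normal_vec)"
  proof (rule Bochner_Integration.integral_cong)
    fix x :: "real ^ 'n"
    have "Q (F x) = Q x" by (rule even) (simp add: F_def)
    then show "F x $ i * F x $ j / Q (F x) = - (x $ i * x $ j / Q x)"
      using \<open>i \<noteq> j\<close> by (simp add: F_def)
  qed simp
  finally show ?thesis by simp
qed

text \<open>
  In the coordinates \<open>x = U y\<close>, with \<open>y\<close> again standard normal, the denominator is a weighted sum
  of squares of the \<open>y $ j\<close>; so the sign symmetry removes the off-diagonal entries of the
  expectation of \<open>outer y\<close> over this denominator.
\<close>

lemma second_moment_diagonalized: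
  fixes A :: "real ^ 'd ^ 'm"
  defines "F \<equiv> \<lambda>x :: real ^ 'd. (1 / (norm (A *v x))\<^sup>2) *\<^sub>R outer x"
  assumes U: "orthogonal_matrix U" and S: "transpose A ** A = U ** diag_matrix lam ** transpose U"
    and F: "integrable std_normal_vec F"
  defines "f \<equiv> \<lambda>i x. (x $ i)\<^sup>2 / (\<Sum>j\<in>UNIV. lam $ j * (x $ j)\<^sup>2)"
  shows "integrable std_normal_vec (f i)"
    and "(\<integral>x. F x \<partial>std_normal_vec)
           = U ** diag_matrix (\<chi> i. \<integral>x. f i x \<partial>std_normal_vec) ** transpose U"
proof -
  define Q where "Q x = (\<Sum>j\<in>UNIV. lam $ j * (x $ j)\<^sup>2)" for x :: "real ^ 'd"
  define G where "G x = (1 / Q x) *\<^sub>R outer x" for x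
  let ?N = "std_normal_vec :: (real ^ 'd) measure"
  have [measurable]: "Q \<in> borel_measurable borel"
    unfolding Q_def by measurable
  have U_meas [measurable]: "(*v) U \<in> borel_measurable borel"
    by (intro borel_measurable_linear matrix_vector_mul_linear)
  have inv: "distr ?N borel ((*v) U) = ?N"
    using U by (intro distr_std_normal_vec_orthogonal) (rule orthogonal_matrix_imp_transformation)
  have UU: "transpose U ** U = mat 1" "U ** transpose U = mat 1"
    using U by (simp_all add: orthogonal_matrix_def)
  have FU: "F (U *v x) = U ** G x ** transpose U" for x
    using norm_square_diagonalized[OF U S, of "U *v x"]
    by (simp add: F_def G_def Q_def orthogonal_matrix_columns[OF U] outer_matrix_vector
        linear_simps(5)[OF bounded_linear_matrix_conj])
  have GF: "G x = transpose U ** F (U *v x) ** U" for x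
    unfolding FU by (simp add: UU matrix_mul_assoc) (simp add: UU matrix_mul_assoc[symmetric])
  have F_meas: "F \<in> borel_measurable borel"
    using F by (auto dest: borel_measurable_integrable simp: measurable_def)
  have "integrable (distr ?N borel ((*v) U)) F"
    using F by (simp add: inv)
  then have FU_int: "integrable ?N (\<lambda>x. F (U *v x))"
    by (rule integrable_distr[OF U_meas[unfolded measurable_cong_sets[OF sets_std_normal_vec[symmetric] refl]], rotated])
  then have G_int: "integrable ?N G"
    unfolding GF by (rule integrable_bounded_linear[OF bounded_linear_matrix_conj])
  have G_entry: "G x $ k $ l = x $ k * x $ l / Q x" for x k l
    by (simp add: G_def outer_def)
  have bl: "bounded_linear (\<lambda>M :: real ^ 'd ^ 'd. M $ k $ l)" for k l
    by (intro bounded_linear_compose[OF bounded_linear_vec_nth] bounded_linear_vec_nth)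
  have entry_int: "integrable ?N (\<lambda>x. x $ k * x $ l / Q x)" for k l
    using integrable_bounded_linear[OF bl G_int] by (simp add: G_entry)
  then show "integrable ?N (f i)"
    unfolding f_def using entry_int[of i i] by (simp add: Q_def power2_eq_square)
  have entry: "(\<integral>x. G x \<partial>?N) $ k $ l = (\<integral>x. x $ k * x $ l / Q x \<partial>?N)" for k l
    using integral_bounded_linear[OF bl G_int] by (simp add: G_entry)
  have G_integral: "(\<integral>x. G x \<partial>?N) = diag_matrix (\<chi> i. \<integral>x. f i x \<partial>?N)"
    unfolding vec_eq_iff entry
    by (auto simp: diag_matrix_def f_def Q_def power2_eq_square[symmetric]
        intro!: gaussian_sign_symmetry)
  have "(\<integral>x. F x \<partial>?N) = (\<integral>x. F (U *v x) \<partial>?N)"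
    using F_meas by (subst inv[symmetric], subst integral_distr) auto
  also have "\<dots> = U ** (\<integral>x. G x \<partial>?N) ** transpose U"
    unfolding FU by (rule integral_bounded_linear[OF bounded_linear_matrix_conj G_int])
  finally show "(\<integral>x. F x \<partial>?N) = U ** diag_matrix (\<chi> i. \<integral>x. f i x \<partial>?N) ** transpose U"
    by (simp add: G_integral)
qed

text \<open>
  The case in which all \<open>l j\<close> vanish is separate: there the left side of the first inequality is 0
  by the convention \<open>1 / 0 = 0\<close>. Otherwise that inequality is the weakening of the lower bound
  \<open>2 / (pi * (\<Sum>j. l j))\<close> by \<open>Gamma_half_ratio_le\<close>.
\<close>

lemma gaussian_quotient_bounds:
  fixes l :: "'n::finite \<Rightarrow> real" and i :: 'n
  defines "f \<equiv> \<lambda>x :: real ^ 'n. (x $ i)\<^sup>2 / (\<Sum>j\<in>UNIV. l j * (x $ j)\<^sup>2)"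
  defines "mu \<equiv> \<integral>x. f x \<partial>std_normal_vec"
  assumes l: "\<And>j. l j \<ge> 0" and d: "CARD('n) > 2" and f: "integrable std_normal_vec f"
  shows "1 / (2 * (\<Sum>j\<in>UNIV. l j)) * (Gamma (real CARD('n) / 2) / Gamma ((real CARD('n) + 1) / 2)) \<le> mu"
    and "(\<Prod>j\<in>UNIV. l j) \<noteq> 0 \<Longrightarrow>
           mu \<le> 1 / (real CARD('n) * (\<Prod>j\<in>UNIV. l j) powr (1 / real CARD('n)))
                  * (1 / pi powr (real CARD('n) / 2))
                  * Gamma (3 / 2 - 1 / real CARD('n))
                  * Gamma (1 / 2 - 1 / real CARD('n)) ^ (CARD('n) - 1)"
proof -
  have f_nonneg: "f x \<ge> 0" for x
    unfolding f_def using l by (intro divide_nonneg_nonneg sum_nonneg) auto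
  have mu_nonneg: "mu \<ge> 0"
    unfolding mu_def using f_nonneg by (intro Bochner_Integration.integral_nonneg)
  have nn: "(\<integral>\<^sup>+x. ennreal (f x) \<partial>std_normal_vec) = ennreal mu"
    unfolding mu_def using f f_nonneg by (intro nn_integral_eq_integral) auto
  let ?s = "\<Sum>j\<in>UNIV. l j"
  show "1 / (2 * ?s) * (Gamma (real CARD('n) / 2) / Gamma ((real CARD('n) + 1) / 2)) \<le> mu"
  proof (cases "?s > 0")
    case True
    have "1 / (2 * ?s) * (Gamma (real CARD('n) / 2) / Gamma ((real CARD('n) + 1) / 2))
        \<le> 1 / (2 * ?s) * (4 / pi)"
      using True d by (intro mult_left_mono Gamma_half_ratio_le) auto
    also have "\<dots> = 2 / (pi * ?s)"
      by simp
    also have "\<dots> \<le> mu"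
      using gaussian_quotient_lower_bound[of l i, OF l True] mu_nonneg
      unfolding nn[unfolded f_def] by simp
    finally show ?thesis .
  next
    case False
    then have "?s = 0"
      using l by (simp add: antisym sum_nonneg)
    then show ?thesis using mu_nonneg by simp
  qed
  assume "(\<Prod>j\<in>UNIV. l j) \<noteq> 0"
  then have pos: "l j > 0" for j
    using l[of j] by (simp add: order_less_le)
  have "0 \<le> 1 / (real CARD('n) * (\<Prod>j\<in>UNIV. l j) powr (1 / real CARD('n)))
                  * (1 / pi powr (real CARD('n) / 2))
                  * Gamma (3 / 2 - 1 / real CARD('n))
                  * Gamma (1 / 2 - 1 / real CARD('n)) ^ (CARD('n) - 1)"
  proof -
    have "1 / real CARD('n) < 1 / 2"
      using d by (simp add: field_simps)
    then have "Gamma (3 / 2 - 1 / real CARD('n)) > 0" "Gamma (1 / 2 - 1 / real CARD('n)) > 0"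
      by (intro Gamma_real_pos; linarith)+
    then show ?thesis by simp
  qed
  then show "mu \<le> 1 / (real CARD('n) * (\<Prod>j\<in>UNIV. l j) powr (1 / real CARD('n)))
                  * (1 / pi powr (real CARD('n) / 2))
                  * Gamma (3 / 2 - 1 / real CARD('n))
                  * Gamma (1 / 2 - 1 / real CARD('n)) ^ (CARD('n) - 1)"
    using gaussian_quotient_upper_bound[of l i, OF pos d]
    unfolding nn[unfolded f_def] by (simp only: ennreal_le_iff)
qed

theorem lemma3p16:
  fixes A :: "real ^ 'd ^ 'm"
    and P :: "'w measure" and X :: "'w \<Rightarrow> real ^ 'd"
    and M :: "real ^ 'd ^ 'd"
  assumes dims: "CARD('m) > CARD('d)" "CARD('d) > 2"
    and P: "prob_space P"
    and X: "X \<in> borel_measurable P"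
    and law: "distr P borel X = std_normal_vec \<or>
              distr P borel X = unif_sphere (sqrt (real CARD('d)))"
    and M_exists: "integrable P (\<lambda>\<omega>. (1 / (norm (A *v X \<omega>))\<^sup>2) *\<^sub>R outer (X \<omega>))"
    and M: "M = (\<integral>\<omega>. (1 / (norm (A *v X \<omega>))\<^sup>2) *\<^sub>R outer (X \<omega>) \<partial>P)"
  shows "(\<exists>U lam mu. orthogonal_matrix U
            \<and> transpose A ** A = U ** diag_matrix lam ** transpose U
            \<and> M = U ** diag_matrix mu ** transpose U)
       \<and> (\<forall>U lam. orthogonal_matrix U
            \<and> transpose A ** A = U ** diag_matrix lam ** transpose U \<longrightarrow>
          (\<exists>mu. M = U ** diag_matrix mu ** transpose U
            \<and> (\<forall>i. mu $ i = (\<integral>\<omega>. (column i U \<bullet> X \<omega>)\<^sup>2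
                              / (\<Sum>j\<in>UNIV. lam $ j * (column j U \<bullet> X \<omega>)\<^sup>2) \<partial>P)
               \<and> 1 / (2 * (\<Sum>j\<in>UNIV. lam $ j))
                   * (Gamma (real CARD('d) / 2) / Gamma ((real CARD('d) + 1) / 2)) \<le> mu $ i
               \<and> ((\<Prod>j\<in>UNIV. lam $ j) \<noteq> 0 \<longrightarrow>
                  mu $ i \<le> 1 / (real CARD('d) * (\<Prod>j\<in>UNIV. lam $ j) powr (1 / real CARD('d)))
                         * (1 / pi powr (real CARD('d) / 2))
                         * Gamma (3 / 2 - 1 / real CARD('d))
                         * Gamma (1 / 2 - 1 / real CARD('d)) ^ (CARD('d) - 1)))))"
    (is "?diagonalizable \<and> (\<forall>U lam. ?spectral U lam \<longrightarrow> (\<exists>mu. ?conclusion U lam mu))")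
proof -
  define F where "F x = (1 / (norm (A *v x))\<^sup>2) *\<^sub>R outer x" for x :: "real ^ 'd"
  have [measurable]: "(*v) A \<in> borel_measurable borel"
    by (intro borel_measurable_linear matrix_vector_mul_linear)
  have outer_meas [measurable]: "outer \<in> borel_measurable (borel :: (real ^ 'd) measure)"
    unfolding outer_def by (intro borel_measurable_continuous_onI continuous_intros)
  have F_meas: "F \<in> borel_measurable borel"
    unfolding F_def by measurable
  have F_hom: "F (c *\<^sub>R x) = F x" if "c > 0" for c x
    using that by (simp add: F_def outer_def vec_eq_iff matrix_vector_mult_scaleR power2_eq_square)
  have r: "sqrt (real CARD('d)) > 0" by simp
  note to_gaussian = homogeneous_integral_eq_gaussian[OF X law r]
  have F_int: "integrable std_normal_vec F"
  proof -
    have "integrable P (\<lambda>\<omega>. F (X \<omega>))"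
      using M_exists by (simp add: F_def)
    then show ?thesis
      using to_gaussian(1)[where G = F, OF F_meas F_hom] by simp
  qed
  have M_eq: "M = (\<integral>x. F x \<partial>std_normal_vec)"
  proof -
    have "M = (\<integral>\<omega>. F (X \<omega>) \<partial>P)"
      using M by (simp add: F_def)
    then show ?thesis
      using to_gaussian(2)[where G = F, OF F_meas F_hom] by simp
  qed
  have main: "\<exists>mu. ?conclusion U lam mu" if *: "?spectral U lam" for U lam
  proof -
    have U: "orthogonal_matrix U" and S: "transpose A ** A = U ** diag_matrix lam ** transpose U"
      using * by auto
    define f where "f i x = (x $ i)\<^sup>2 / (\<Sum>j\<in>UNIV. lam $ j * (x $ j)\<^sup>2)" for i and x :: "real ^ 'd"
    define mu where "mu = (\<chi> i. \<integral>x. f i x \<partial>std_normal_vec)"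
    have f_int: "integrable std_normal_vec (f i)" for i
      using second_moment_diagonalized(1)[OF U S] F_int unfolding F_def f_def by blast
    have M_diag: "M = U ** diag_matrix mu ** transpose U"
      using second_moment_diagonalized(2)[OF U S] F_int unfolding M_eq F_def f_def mu_def by blast
    \<comment> \<open>\<open>lam $ j\<close> is the squared norm of \<open>A\<close> applied to the column \<open>j\<close> of \<open>U\<close>.\<close>
    have lam: "lam $ j \<ge> 0" for j
      using norm_square_diagonalized[OF U S, of "U *v axis j 1"]
      by (simp add: orthogonal_matrix_columns[OF U] axis_def if_distrib[of "\<lambda>a. a\<^sup>2"]
          if_distrib[of "\<lambda>a. _ * a"] cong: if_cong) (metis zero_le_power2)
    have mu_eq: "mu $ i = (\<integral>\<omega>. (column i U \<bullet> X \<omega>)\<^sup>2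
                      / (\<Sum>j\<in>UNIV. lam $ j * (column j U \<bullet> X \<omega>)\<^sup>2) \<partial>P)" for i
    proof -
      define h where "h x = (column i U \<bullet> x)\<^sup>2 / (\<Sum>j\<in>UNIV. lam $ j * (column j U \<bullet> x)\<^sup>2)" for x
      have h_meas [measurable]: "h \<in> borel_measurable borel"
        unfolding h_def by measurable
      have h_hom: "h (c *\<^sub>R x) = h x" if "c > 0" for c x
      proof -
        have "(\<Sum>j\<in>UNIV. lam $ j * (column j U \<bullet> (c *\<^sub>R x))\<^sup>2)
            = c\<^sup>2 * (\<Sum>j\<in>UNIV. lam $ j * (column j U \<bullet> x)\<^sup>2)"
          by (simp add: sum_distrib_left power_mult_distrib mult_ac)
        then show ?thesis
          using that by (simp add: h_def power_mult_distrib)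
      qed
      have U_meas: "(*v) U \<in> borel_measurable borel"
        by (intro borel_measurable_linear matrix_vector_mul_linear)
      \<comment> \<open>Rotate by \<open>U\<close> under the Gaussian law, then return to the law of \<open>X\<close> by homogeneity.\<close>
      have "mu $ i = (\<integral>x. h (U *v x) \<partial>std_normal_vec)"
        by (simp add: mu_def f_def h_def orthogonal_matrix_columns[OF U])
      also have "\<dots> = (\<integral>x. h x \<partial>distr std_normal_vec borel ((*v) U))"
        using U_meas by (intro integral_distr[symmetric]) auto
      also have "distr std_normal_vec borel ((*v) U) = std_normal_vec"
        using U by (intro distr_std_normal_vec_orthogonal) (rule orthogonal_matrix_imp_transformation)
      also have "(\<integral>x. h x \<partial>std_normal_vec) = (\<integral>\<omega>. h (X \<omega>) \<partial>P)"
        using to_gaussian(2)[where G = h, OF h_meas h_hom] by simp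
      finally show ?thesis by (simp add: h_def)
    qed
    have mu_f: "mu $ i = (\<integral>x. (x $ i)\<^sup>2 / (\<Sum>j\<in>UNIV. lam $ j * (x $ j)\<^sup>2) \<partial>std_normal_vec)" for i
      by (simp add: mu_def f_def)
    note bounds = gaussian_quotient_bounds[of "\<lambda>j. lam $ j", OF lam dims(2) f_int[unfolded f_def],
        folded mu_f]
    show ?thesis
      by (intro exI[of _ mu] conjI allI impI) (rule M_diag mu_eq bounds | assumption)+
  qed
  have "transpose (transpose A ** A) = transpose A ** A"
    by (simp add: matrix_transpose_mul)
  then obtain U lam where U: "orthogonal_matrix U"
    and S: "transpose A ** A = U ** diag_matrix lam ** transpose U"
    by (rule symmetric_matrix_diagonalizable)
  then obtain mu where "M = U ** diag_matrix mu ** transpose U"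
    using main[of U lam] by blast
  with U S have ?diagonalizable by blast
  with main show ?thesis by blast
qed

end
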